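(* If two consecutive iterations $c$ and $c+1$ of the Inner-Approximation algorithm lead to the same solution of the lower bound problem, i.e. $z^{\tau+c+1}=z^{\tau+c}$, then this solution is optimal for the original problem $\min_{x\in X} f(x)+\phi(x)$.
   Context: Setting. Let $x^l,x^u\in\mathbb{R}^n$ with $x^l_k\le x^u_k$, and $B=\{x\in\mathbb{R}^n: x^l_k\le x_k\le x^u_k,\ k=1,\dots,n\}$. Let $D\subseteq\mathbb{R}^n$ be a convex set with $B\subseteq D$ (the domain of $\phi$), let $\phi:D\to\mathbb{R}$ be strictly concave, and let $f,g_1,\dots,g_I:D\to\mathbb{R}$ be convex; all these functions are Lipschitz continuous (Euclidean norm). Let $J\subseteq\{1,\dots,n\}$ be an arbitrary (possibly empty) set of indices of variables required to be integer. The feasible set is $$X=\{x\in B:\ g_i(x)\le 0\ (i=1,\dots,I),\ x_k\in\mathbb{Z}\ (k\in J)\}.$$ Inner approximation. For a finite set $S=\{z^1,\dots,z^{N}\}\subset D$ and $x\in\operatorname{conv}S$, $$\hat\phi(x|S)=\max_{\mu}\Big\{\sum_{j=1}^{N}\mu_j\phi(z^j):\ \sum_{j=1}^{N}\mu_j=1,\ \sum_{j=1}^{N}\mu_j z^j=x,\ \mu_j\ge 0\ (j=1,\dots,N)\Big\}.$$ Inner-Approximation algorithm. Start with a finite set $S_1=\{z^1,\dots,z^\tau\}\subset D$ with $D\subseteq\operatorname{conv}S_1$. At iteration $c=1,2,\dots$, let $z^{\tau+c}$ be an optimal solution $x$ of the lower bound problem $$\min_{x\in X} f(x)+\hat\phi(x|S_c),$$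 (solved by the paper through its KKT reformulation, called Mod-$S_c$), and set $S_{c+1}=S_c\cup\{z^{\tau+c}\}$. *)

theory Defs
  imports "HOL-Analysis.Analysis"
begin

definition strictly_concave_on :: "'a::real_vector set \<Rightarrow> ('a \<Rightarrow> real) \<Rightarrow> bool" where
  "strictly_concave_on D \<phi> \<longleftrightarrow> convex D \<and>
     (\<forall>x\<in>D. \<forall>y\<in>D. \<forall>u>0. \<forall>v>0. x \<noteq> y \<and> u + v = 1 \<longrightarrow>
        u * \<phi> x + v * \<phi> y < \<phi> (u *\<^sub>R x + v *\<^sub>R y))"

definition lipschitz_continuous_on :: "'a::metric_space set \<Rightarrow> ('a \<Rightarrow> real) \<Rightarrow> bool" where
  "lipschitz_continuous_on D h \<longleftrightarrow> (\<exists>L. L-lipschitz_on D h)"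

definition feasible_set ::
  "real^'n \<Rightarrow> real^'n \<Rightarrow> nat \<Rightarrow> (nat \<Rightarrow> real^'n \<Rightarrow> real) \<Rightarrow> 'n set \<Rightarrow> (real^'n) set" where
  "feasible_set xl xu I g J =
     {x \<in> cbox xl xu. (\<forall>i\<in>{1..I}. g i x \<le> 0) \<and> (\<forall>k\<in>J. x $ k \<in> \<int>)}"

(* GREATEST returns the maximum only if it is attained; for finite S and x in convex hull S
   it is, since the admissible weights form a nonempty compact polytope. *)
definition inner_approximation ::
  "('a::real_vector \<Rightarrow> real) \<Rightarrow> 'a set \<Rightarrow> 'a \<Rightarrow> real" where
  "inner_approximation \<phi> S x =
     (GREATEST v. \<exists>\<mu>. v = (\<Sum>y\<in>S. \<mu> y * \<phi> y) \<and>
        sum \<mu> S = 1 \<and> (\<Sum>y\<in>S. \<mu> y *\<^sub>R y) = x \<and> (\<forall>y\<in>S. \<mu> y \<ge> 0))"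

(* z and S record the points and the inner approximation sets of a run through
   iterations 1, ..., m; z i for i = 0 or i > t + m and S c for c = 0 or c > m + 1
   are unconstrained. Any choice of optimal solutions of the lower bound problems is allowed. *)
definition inner_approximation_run ::
  "(real^'n) set \<Rightarrow> (real^'n) set \<Rightarrow> (real^'n \<Rightarrow> real) \<Rightarrow> (real^'n \<Rightarrow> real) \<Rightarrow>
     nat \<Rightarrow> (nat \<Rightarrow> real^'n) \<Rightarrow> (nat \<Rightarrow> (real^'n) set) \<Rightarrow> nat \<Rightarrow> bool" where
  "inner_approximation_run D X f \<phi> t z S m \<longleftrightarrow>
     S 1 = z ` {1..t} \<and> S 1 \<subseteq> D \<and> D \<subseteq> convex hull (S 1) \<and>
     (\<forall>c\<in>{1..m}.
        is_arg_min (\<lambda>x. f x + inner_approximation \<phi> (S c) x) (\<lambda>x. x \<in> X) (z (t + c)) \<and>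
        S (c + 1) = S c \<union> {z (t + c)})"

end

theory Submission
  imports Defs
begin

text \<open>
  By Jensen's inequality the inner approximation of a concave function lies below that function,
  with equality at the points of the approximating set. The point produced in iteration \<open>c\<close>
  belongs to \<open>S (c + 1)\<close>, so if it also solves the lower bound problem of iteration \<open>c + 1\<close>,
  the lower bound is attained there by the original objective.
\<close>

lemma strictly_concave_on_imp_concave_on:
  assumes "strictly_concave_on D \<phi>"
  shows "concave_on D \<phi>"
proof -
  have "u * \<phi> x + v * \<phi> y \<le> \<phi> (u *\<^sub>R x + v *\<^sub>R y)"
    if "x \<in> D" "y \<in> D" "u \<ge> 0" "v \<ge> 0" "u + v = 1" for x y u v
  \<comment> \<open>The definition of strict concavity speaks only of distinct points and positive
    weights; in the remaining cases both sides coincide.\<close>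
  proof (cases "x = y \<or> u = 0 \<or> v = 0")
    case True
    then show ?thesis
      using that by (auto simp flip: scaleR_left_distrib distrib_right)
  next
    case False
    then show ?thesis
      using assms that unfolding strictly_concave_on_def by (simp add: less_imp_le)
  qed
  then show ?thesis
    using assms by (auto simp: concave_on_iff strictly_concave_on_def)
qed

text \<open>The admissible values form a slice of the convex hull of the graph of \<open>\<phi>\<close> over \<open>S\<close>,
  which is compact.\<close>

lemma inner_approximation_attained:
  fixes \<phi> :: "'a::euclidean_space \<Rightarrow> real"
  assumes "finite S" and "x \<in> convex hull S"
  shows "\<exists>\<mu>. inner_approximation \<phi> S x = (\<Sum>y\<in>S. \<mu> y * \<phi> y) \<and>
    sum \<mu> S = 1 \<and> (\<Sum>y\<in>S. \<mu> y *\<^sub>R y) = x \<and> (\<forall>y\<in>S. \<mu> y \<ge> 0)"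
proof -
  define P where "P v \<longleftrightarrow> (\<exists>\<mu>. v = (\<Sum>y\<in>S. \<mu> y * \<phi> y) \<and>
    sum \<mu> S = 1 \<and> (\<Sum>y\<in>S. \<mu> y *\<^sub>R y) = x \<and> (\<forall>y\<in>S. \<mu> y \<ge> 0))" for v
  define G where "G = (\<lambda>y. (y, \<phi> y)) ` S"
  \<comment> \<open>Lets sums over the graph \<open>G\<close> be reindexed as sums over
    \<open>S\<close>, even where \<open>\<phi>\<close> takes equal values.\<close>
  have inj: "inj_on (\<lambda>y. (y, \<phi> y)) S"
    by (auto simp: inj_on_def)
  have P_iff: "P v \<longleftrightarrow> (x, v) \<in> convex hull G" for v
  proof
    assume "P v"
    then obtain \<mu> where \<mu>: "v = (\<Sum>y\<in>S. \<mu> y * \<phi> y)" "sum \<mu> S = 1"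
      "(\<Sum>y\<in>S. \<mu> y *\<^sub>R y) = x" "\<forall>y\<in>S. \<mu> y \<ge> 0"
      unfolding P_def by blast
    have "(\<Sum>y\<in>S. \<mu> y *\<^sub>R (y, \<phi> y)) \<in> convex hull G"
      using \<mu> assms(1) by (intro convex_sum) (auto simp: G_def intro: hull_inc)
    also have "(\<Sum>y\<in>S. \<mu> y *\<^sub>R (y, \<phi> y)) = (x, v)"
      using \<mu> by (simp add: prod_eq_iff fst_sum snd_sum)
    finally show "(x, v) \<in> convex hull G" .
  next
    assume "(x, v) \<in> convex hull G"
    then obtain u where u: "\<forall>p\<in>G. 0 \<le> u p" "sum u G = 1" "(\<Sum>p\<in>G. u p *\<^sub>R p) = (x, v)"
      using assms(1) by (auto simp: convex_hull_finite G_def)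
    have "(\<Sum>y\<in>S. u (y, \<phi> y) *\<^sub>R (y, \<phi> y)) = (x, v)" "(\<Sum>y\<in>S. u (y, \<phi> y)) = 1"
      using u(2,3) inj by (simp_all add: G_def sum.reindex o_def)
    then show "P v"
      using u(1) unfolding P_def
      by (intro exI[of _ "\<lambda>y. u (y, \<phi> y)"]) (auto simp: prod_eq_iff fst_sum snd_sum G_def)
  qed
  have "Collect P = snd ` (convex hull G \<inter> fst -` {x})"
    by (force simp: P_iff)
  moreover have "compact (convex hull G \<inter> fst -` {x})"
    using assms(1) by (intro compact_Int_closed finite_imp_compact_convex_hull closed_vimage_fst)
      (auto simp: G_def)
  ultimately have "compact (Collect P)"
    by (simp add: compact_continuous_image continuous_on_snd)
  moreover have "Collect P \<noteq> {}"
    using assms by (auto simp: P_def convex_hull_finite)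
  ultimately obtain w where "P w" "\<And>v. P v \<Longrightarrow> v \<le> w"
    using compact_attains_sup[of "Collect P"] by auto
  \<comment> \<open>\<open>Greatest\<close> is only meaningful once a maximum is known to exist;
    \<open>w\<close> is that maximum, supplied by compactness.\<close>
  then have "P (Greatest P)"
    by (rule GreatestI2_order)
  then show ?thesis
    unfolding inner_approximation_def P_def .
qed

text \<open>Jensen's inequality for the convex function \<open>- \<phi>\<close>. It bounds every
  admissible value in the definition of the inner approximation.\<close>

lemma concave_on_weighted_sum_le:
  assumes "concave_on D \<phi>" "finite S" "S \<subseteq> D" "sum \<mu> S = 1" "\<forall>y\<in>S. \<mu> y \<ge> 0"
  shows "(\<Sum>y\<in>S. \<mu> y * \<phi> y) \<le> \<phi> (\<Sum>y\<in>S. \<mu> y *\<^sub>R y)"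
proof -
  have "S \<noteq> {}"
    using assms(4) by auto
  then show ?thesis
    using convex_on_sum[of S D "\<lambda>x. - \<phi> x" \<mu> "\<lambda>y. y"] assms
    by (auto simp: concave_on_def sum_negf)
qed

text \<open>The inner approximation is itself the value of some admissible weights, so Jensen's
  inequality applies to it.\<close>

lemma inner_approximation_le:
  fixes \<phi> :: "'a::euclidean_space \<Rightarrow> real"
  assumes "concave_on D \<phi>" "finite S" "S \<subseteq> D" "x \<in> convex hull S"
  shows "inner_approximation \<phi> S x \<le> \<phi> x"
  using inner_approximation_attained[OF assms(2,4), of \<phi>] concave_on_weighted_sum_le[OF assms(1-3)]
  by metis

text \<open>Putting all weight on \<open>x\<close> yields the value \<open>\<phi> x\<close>, and by
  Jensen's inequality no other weights exceed it. The maximum is exhibited directly, so no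
  compactness argument enters.\<close>

lemma inner_approximation_eq:
  assumes "concave_on D \<phi>" "finite S" "S \<subseteq> D" "x \<in> S"
  shows "inner_approximation \<phi> S x = \<phi> x"
  unfolding inner_approximation_def
proof (rule Greatest_equality, goal_cases)
  case 1
  have "(\<Sum>y\<in>S. (if y = x then 1 else 0) *\<^sub>R y) = (\<Sum>y\<in>S. if y = x then y else 0)"
    by (intro sum.cong) auto
  moreover have "(\<Sum>y\<in>S. (if y = x then 1 else 0) * \<phi> y) = (\<Sum>y\<in>S. if y = x then \<phi> y else 0)"
    by (intro sum.cong) auto
  ultimately show ?case
    using assms(2,4) by (intro exI[of _ "\<lambda>y. if y = x then 1 else 0"]) simp
next
  case (2 v)
  then show ?case
    using concave_on_weighted_sum_le[OF assms(1-3)] by blast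
qed

text \<open>Each iteration adds a feasible point, hence a point of \<open>D\<close>, and the hull
  can only grow. The index is shifted because the sets start at \<open>S 1\<close>.\<close>

lemma inner_approximation_run_sets:
  assumes "inner_approximation_run D X f \<phi> t z S m" "X \<subseteq> D" "c \<le> m"
  shows "finite (S (c + 1)) \<and> S (c + 1) \<subseteq> D \<and> D \<subseteq> convex hull S (c + 1)"
  using assms(3)
proof (induction c)
  case 0
  have "finite (S 1)" "S 1 \<subseteq> D" "D \<subseteq> convex hull S 1"
    using assms(1) by (auto simp: inner_approximation_run_def)
  then show ?case
    by simp
next
  case (Suc c)
  have "\<forall>c\<in>{1..m}. z (t + c) \<in> X \<and> S (c + 1) = S c \<union> {z (t + c)}"
    using assms(1) by (simp add: inner_approximation_run_def is_arg_min_def)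
  from bspec[OF this, of "Suc c"] have step: "S (Suc c + 1) = S (c + 1) \<union> {z (t + Suc c)}" "z (t + Suc c) \<in> X"
    using Suc.prems by simp_all
  then have "convex hull S (c + 1) \<subseteq> convex hull S (Suc c + 1)"
    by (intro hull_mono) auto
  moreover have "finite (S (c + 1)) \<and> S (c + 1) \<subseteq> D \<and> D \<subseteq> convex hull S (c + 1)"
    using Suc by simp
  ultimately show ?case
    using step assms(2) by auto
qed

theorem theorem4:
  fixes xl xu :: "real^'n" and D :: "(real^'n) set"
    and \<phi> f :: "real^'n \<Rightarrow> real" and g :: "nat \<Rightarrow> real^'n \<Rightarrow> real" and I :: nat
    and J :: "'n set" and t c :: nat
    and z :: "nat \<Rightarrow> real^'n" and S :: "nat \<Rightarrow> (real^'n) set"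
  assumes "\<forall>k. xl $ k \<le> xu $ k"
    and "convex D" and "cbox xl xu \<subseteq> D"
    and "strictly_concave_on D \<phi>" and "convex_on D f" and "\<forall>i\<in>{1..I}. convex_on D (g i)"
    and "lipschitz_continuous_on D \<phi>" and "lipschitz_continuous_on D f"
    and "\<forall>i\<in>{1..I}. lipschitz_continuous_on D (g i)"
    and "c \<ge> 1"
    and "inner_approximation_run D (feasible_set xl xu I g J) f \<phi> t z S (c + 1)"
    and "z (t + c + 1) = z (t + c)"
  shows "is_arg_min (\<lambda>x. f x + \<phi> x) (\<lambda>x. x \<in> feasible_set xl xu I g J) (z (t + c))"
proof -
  let ?X = "feasible_set xl xu I g J" and ?p = "z (t + c)"
  have X_D: "?X \<subseteq> D"
    using assms(3) by (auto simp: feasible_set_def)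
  have conc: "concave_on D \<phi>"
    using assms(4) by (rule strictly_concave_on_imp_concave_on)
  have S: "finite (S (c + 1))" "S (c + 1) \<subseteq> D" "D \<subseteq> convex hull S (c + 1)"
    using inner_approximation_run_sets[OF assms(11) X_D, of c] by auto
  have "?p \<in> S (c + 1)"
    using assms(10,11) by (simp add: inner_approximation_run_def)
  then have p_eq: "inner_approximation \<phi> (S (c + 1)) ?p = \<phi> ?p"
    by (rule inner_approximation_eq[OF conc S(1,2)])
  \<comment> \<open>Iteration \<open>c + 1\<close> minimises over the set that already contains the
    point of iteration \<open>c\<close>.\<close>
  have "is_arg_min (\<lambda>x. f x + inner_approximation \<phi> (S (c + 1)) x) (\<lambda>x. x \<in> ?X) (z (t + (c + 1)))"
    using assms(11) unfolding inner_approximation_run_def by (meson atLeastAtMost_iff le_add2 order_refl)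
  then have p_min: "is_arg_min (\<lambda>x. f x + inner_approximation \<phi> (S (c + 1)) x) (\<lambda>x. x \<in> ?X) ?p"
    using assms(12) by (simp add: add.assoc)
  \<comment> \<open>At \<open>?p\<close> the lower bound is exact, and at any feasible
    \<open>x\<close> it does not exceed the true objective.\<close>
  have "f ?p + \<phi> ?p \<le> f x + \<phi> x" if "x \<in> ?X" for x
  proof -
    have "f ?p + \<phi> ?p \<le> f x + inner_approximation \<phi> (S (c + 1)) x"
      using p_min that p_eq by (auto simp: is_arg_min_linorder)
    also have "\<dots> \<le> f x + \<phi> x"
      using inner_approximation_le[OF conc S(1,2)] that X_D S(3) by auto
    finally show ?thesis .
  qed
  with p_min show ?thesis
    by (simp add: is_arg_min_linorder)
qed

end
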